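(* Let $A \in S^{n\times n}$ be not positive semidefinite, $a,x_0,b_1,\ldots,b_m\in\mathbb{R}^n$, $\alpha>0$ and $\beta_1,\ldots,\beta_m\in\mathbb{R}$. Consider the problem $$(P)\quad \min_{x\in\mathbb{R}^n}\ x^TAx+a^Tx \quad \mbox{s.t.}\quad \|x-x_0\|^2\le\alpha,\ \ b_i^Tx\le\beta_i,\ i=1,\ldots,m,$$ and its semidefinite relaxation $$(SDRP)\quad \min_{X\in S^{n+1}_+}\ {\rm Tr}(MX)\quad \mbox{s.t.}\quad {\rm Tr}(H_0X)\le 0,\ \ {\rm Tr}(H_iX)\le 0,\ i=1,\ldots,m,\ \ X_{n+1,n+1}=1,$$ where $$M=\left(\begin{array}{cc} A & a/2\\ a^T/2 & 0\end{array}\right),\quad H_0=\left(\begin{array}{cc} I_n & -x_0\\ -x_0^T & \|x_0\|^2-\alpha\end{array}\right),\quad H_i=\left(\begin{array}{cc} 0 & b_i/2\\ b_i^T/2 & -\beta_i\end{array}\right),\ i=1,\ldots,m.$$ Let $s={\rm dim}\,{\rm span}\{b_1,\ldots,b_m\}$ and suppose that ${\rm dim}\,{\rm Ker}(A-\lambda_{\min}(A)I_n)\ge s+1$. Then the semidefinite relaxation is exact, i.e., $\min(P)=\min(SDRP)$.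
   Context: $S^{n\times n}$ is the space of real symmetric $n\times n$ matrices, $S^{n+1}_+$ is the set of positive semidefinite symmetric $(n+1)\times(n+1)$ matrices, $\lambda_{\min}(A)$ is the smallest eigenvalue of $A$, ${\rm Ker}(M)=\{d: Md=0\}$, and $\|\cdot\|$ is the Euclidean norm. $\min(\cdot)$ denotes the optimal value of a problem, with value $+\infty$ if the problem is infeasible. *)

theory Defs
  imports "HOL-Analysis.Analysis"
begin

definition symmetric_mat :: "real^'n^'n \<Rightarrow> bool" where
  "symmetric_mat A \<longleftrightarrow> transpose A = A"

definition pos_semidef :: "real^'n^'n \<Rightarrow> bool" where
  "pos_semidef A \<longleftrightarrow> (\<forall>x. 0 \<le> x \<bullet> (A *v x))"

definition psd_cone :: "(real^'n^'n) set" where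
  "psd_cone = {X. symmetric_mat X \<and> pos_semidef X}"

definition is_eigenvalue :: "real^'n^'n \<Rightarrow> real \<Rightarrow> bool" where
  "is_eigenvalue A l \<longleftrightarrow> (\<exists>v. v \<noteq> 0 \<and> A *v v = l *\<^sub>R v)"

(* Only used for symmetric A, where a least real eigenvalue exists. *)
definition lambda_min :: "real^'n^'n \<Rightarrow> real" where
  "lambda_min A = (LEAST l. is_eigenvalue A l)"

definition Ker :: "real^'n^'n \<Rightarrow> (real^'n) set" where
  "Ker M = {d. M *v d = 0}"

(* The symmetric (n+1) x (n+1) block matrix with rows (B, v) and (v^T, c).
   Its index type is 'n option: Some i stands for i = 1..n and None for n+1. *)
definition bordered :: "real^'n^'n \<Rightarrow> real^'n \<Rightarrow> real \<Rightarrow> real^('n option)^('n option)" where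
  "bordered B v c = (\<chi> i j. case (i, j) of
       (Some k, Some l) \<Rightarrow> B $ k $ l
     | (Some k, None) \<Rightarrow> v $ k
     | (None, Some l) \<Rightarrow> v $ l
     | (None, None) \<Rightarrow> c)"

definition matM :: "real^'n^'n \<Rightarrow> real^'n \<Rightarrow> real^('n option)^('n option)" where
  "matM A a = bordered A (a /\<^sub>R 2) 0"

definition matH0 :: "real^'n \<Rightarrow> real \<Rightarrow> real^('n option)^('n option)" where
  "matH0 x0 \<alpha> = bordered (mat 1) (- x0) ((norm x0)\<^sup>2 - \<alpha>)"

definition matH :: "real^'n \<Rightarrow> real \<Rightarrow> real^('n option)^('n option)" where
  "matH b \<beta> = bordered 0 (b /\<^sub>R 2) (- \<beta>)"

definition P_feasible ::
    "real^'n \<Rightarrow> real \<Rightarrow> nat \<Rightarrow> (nat \<Rightarrow> real^'n) \<Rightarrow> (nat \<Rightarrow> real) \<Rightarrow> (real^'n) set" where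
  "P_feasible x0 \<alpha> m b \<beta> =
     {x. (norm (x - x0))\<^sup>2 \<le> \<alpha> \<and> (\<forall>i\<in>{1..m}. b i \<bullet> x \<le> \<beta> i)}"

definition SDRP_feasible ::
    "real^'n \<Rightarrow> real \<Rightarrow> nat \<Rightarrow> (nat \<Rightarrow> real^'n) \<Rightarrow> (nat \<Rightarrow> real)
      \<Rightarrow> (real^('n option)^('n option)) set" where
  "SDRP_feasible x0 \<alpha> m b \<beta> =
     {X \<in> psd_cone. trace (matH0 x0 \<alpha> ** X) \<le> 0
        \<and> (\<forall>i\<in>{1..m}. trace (matH (b i) (\<beta> i) ** X) \<le> 0)
        \<and> X $ None $ None = 1}"

(* Optimal values are taken in ereal: the infimum over an empty feasible set is \<infinity>. *)
definition min_P ::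
    "real^'n^'n \<Rightarrow> real^'n \<Rightarrow> real^'n \<Rightarrow> real \<Rightarrow> nat \<Rightarrow> (nat \<Rightarrow> real^'n) \<Rightarrow> (nat \<Rightarrow> real)
      \<Rightarrow> ereal" where
  "min_P A a x0 \<alpha> m b \<beta> =
     (INF x \<in> P_feasible x0 \<alpha> m b \<beta>. ereal (x \<bullet> (A *v x) + a \<bullet> x))"

definition min_SDRP ::
    "real^'n^'n \<Rightarrow> real^'n \<Rightarrow> real^'n \<Rightarrow> real \<Rightarrow> nat \<Rightarrow> (nat \<Rightarrow> real^'n) \<Rightarrow> (nat \<Rightarrow> real)
      \<Rightarrow> ereal" where
  "min_SDRP A a x0 \<alpha> m b \<beta> =
     (INF X \<in> SDRP_feasible x0 \<alpha> m b \<beta>. ereal (trace (matM A a ** X)))"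

end

theory Submission
  imports Defs
begin

text \<open>
  Write a feasible matrix of the relaxation as the block matrix with rows \<open>(Y, x)\<close> and
  \<open>(x\<^sup>T, 1)\<close>. Its Schur complement \<open>Z = Y - x x\<^sup>T\<close> is positive semidefinite, and with
  \<open>l = \<lambda>\<^sub>m\<^sub>i\<^sub>n(A)\<close> and \<open>t = Tr Z\<close> the relaxed objective is at least \<open>x\<^sup>T A x + a\<^sup>T x + l t\<close>,
  while the ball constraint reads \<open>\<parallel>x - x\<^sub>0\<parallel>\<^sup>2 + t \<le> \<alpha>\<close>. By the dimension assumption there is
  a unit eigenvector \<open>d\<close> for \<open>l\<close> orthogonal to all \<open>b\<^sub>i\<close>. Moving \<open>x\<close> to \<open>x + r d\<close> where
  \<open>r\<^sup>2 + 2 r d\<^sup>T (x - x\<^sub>0) = t\<close> preserves the linear constraints, increases the squared distance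
  to \<open>x\<^sub>0\<close> by exactly \<open>t\<close>, and changes the objective by \<open>l t + r (2 l d\<^sup>T x\<^sub>0 + a\<^sup>T d)\<close>. The
  last summand is nonpositive after possibly replacing \<open>d\<close> by \<open>- d\<close>.
\<close>

section \<open>Rank-one matrices, symmetry and traces\<close>

definition outer :: "real^'n \<Rightarrow> real^'n \<Rightarrow> real^'n^'n" where
  "outer x y = (\<chi> i j. x $ i * y $ j)"

lemma symmetric_mat_nth: "symmetric_mat A \<Longrightarrow> A $ i $ j = A $ j $ i"
  unfolding symmetric_mat_def by (metis transpose_def vec_lambda_beta)

lemma symmetric_mat_inner:
  fixes A :: "real^'n^'n"
  assumes "symmetric_mat A"
  shows "x \<bullet> (A *v y) = y \<bullet> (A *v x)"
  using assms unfolding symmetric_mat_def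
  by (metis dot_lmul_matrix inner_commute transpose_matrix_vector)

lemma outer_vector_mult: "outer x y *v z = (y \<bullet> z) *\<^sub>R x"
  by (simp add: vec_eq_iff outer_def matrix_vector_mult_def inner_vec_def sum_distrib_left mult_ac)

lemma symmetric_mat_outer: "symmetric_mat (outer x x)"
  by (simp add: symmetric_mat_def outer_def transpose_def vec_eq_iff)

lemma symmetric_mat_diff: "symmetric_mat A \<Longrightarrow> symmetric_mat B \<Longrightarrow> symmetric_mat (A - B)"
  by (simp add: symmetric_mat_def transpose_def vec_eq_iff)

lemma symmetric_mat_scaleR: "symmetric_mat A \<Longrightarrow> symmetric_mat (c *\<^sub>R A)"
  by (simp add: symmetric_mat_def transpose_def vec_eq_iff)

lemma matrix_vector_mult_scaled_id: "(c *\<^sub>R mat 1) *v x = c *\<^sub>R (x :: real^'n)"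
  by (metis matrix_vector_mul_lid scaleR_matrix_vector_assoc)

lemma trace_mult_outer:
  fixes B :: "real^'n^'n"
  shows "trace (B ** outer x x) = x \<bullet> (B *v x)"
  by (simp add: trace_def matrix_matrix_mult_def outer_def matrix_vector_mult_def inner_vec_def
      sum_distrib_left mult_ac)

lemma trace_scaleR: "trace (c *\<^sub>R (A :: real^'n^'n)) = c * trace A"
  by (simp add: trace_def sum_distrib_left)

lemma trace_outer: "trace (outer x x) = x \<bullet> x"
  using trace_mult_outer[of "mat 1" x] by simp

section \<open>Positive semidefinite matrices and the least eigenvalue\<close>

text \<open>Otherwise the form, which vanishes at \<open>v\<close> and has gradient twice
  \<open>B *v v\<close> there, would become negative after a small step against
  \<open>B *v v\<close>.\<close>

lemma psd_quadratic_zero_imp_kernel: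
  fixes B :: "real^'n^'n"
  assumes sym: "symmetric_mat B" and psd: "pos_semidef B" and zero: "v \<bullet> (B *v v) = 0"
  shows "B *v v = 0"
proof (rule ccontr)
  define w where "w = B *v v"
  define c where "c = w \<bullet> (B *v w)"
  \<comment> \<open>The form at \<open>v + e w\<close> is \<open>2 e |w|^2 + c e^2\<close>. Its
    minimizer would divide by \<open>c\<close>, which may be zero; dividing by \<open>c + 1\<close>
    still gives a negative value.\<close>
  define e where "e = - (w \<bullet> w) / (c + 1)"
  assume "B *v v \<noteq> 0"
  then have pos: "w \<bullet> w > 0" by (simp add: w_def)
  have c: "c \<ge> 0" using psd by (simp add: c_def pos_semidef_def)
  have "0 \<le> (v + e *\<^sub>R w) \<bullet> (B *v (v + e *\<^sub>R w))"
    using psd by (simp add: pos_semidef_def)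
  also have "\<dots> = 2 * e * (w \<bullet> w) + e\<^sup>2 * c"
    using symmetric_mat_inner[OF sym, of v w] zero
    by (simp add: matrix_vector_right_distrib matrix_vector_mult_scaleR inner_add_left
        inner_add_right power2_eq_square algebra_simps flip: w_def c_def)
  also have "\<dots> = - ((w \<bullet> w)\<^sup>2 * (c + 2) / (c + 1)\<^sup>2)"
    using c by (simp add: e_def divide_simps power2_eq_square) (simp add: algebra_simps)
  also have "\<dots> < 0"
    using pos c by simp
  finally show False by simp
qed

text \<open>One step of symmetric Gaussian elimination. If the pivot is zero, then so is its row, and
  division by zero makes the subtracted term vanish.\<close>

lemma psd_eliminate:
  fixes Z :: "real^'n^'n" and i j k :: 'n
  assumes sym: "symmetric_mat Z" and psd: "pos_semidef Z"
  defines "z \<equiv> Z *v axis k 1"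
  shows "pos_semidef (Z - (1 / (Z $ k $ k)) *\<^sub>R outer z z)"
    and "symmetric_mat (Z - (1 / (Z $ k $ k)) *\<^sub>R outer z z)"
    and "Z $ k $ k \<ge> 0"
    and "(Z - (1 / (Z $ k $ k)) *\<^sub>R outer z z) $ i $ j = Z $ i $ j - Z $ i $ k * Z $ j $ k / Z $ k $ k"
    and "Z $ k $ k = 0 \<Longrightarrow> Z $ i $ k = 0"
proof -
  let ?e = "axis k 1 :: real^'n"
  have z_nth: "z $ i = Z $ i $ k" for i
    by (simp add: z_def matrix_vector_mul_component inner_axis)
  have kk: "?e \<bullet> (Z *v ?e) = Z $ k $ k"
    by (simp add: inner_axis' z_nth flip: z_def)
  show nonneg: "Z $ k $ k \<ge> 0"
    using psd kk by (metis pos_semidef_def)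
  have null: "z = 0" if "Z $ k $ k = 0"
    using psd_quadratic_zero_imp_kernel[OF sym psd, of ?e] kk that by (simp add: z_def)
  show "Z $ k $ k = 0 \<Longrightarrow> Z $ i $ k = 0"
    using null z_nth by (metis zero_index)
  show "symmetric_mat (Z - (1 / (Z $ k $ k)) *\<^sub>R outer z z)"
    by (intro symmetric_mat_diff symmetric_mat_scaleR symmetric_mat_outer sym)
  show "(Z - (1 / (Z $ k $ k)) *\<^sub>R outer z z) $ i $ j = Z $ i $ j - Z $ i $ k * Z $ j $ k / Z $ k $ k"
    by (simp add: outer_def z_nth)
  show "pos_semidef (Z - (1 / (Z $ k $ k)) *\<^sub>R outer z z)"
    unfolding pos_semidef_def
  proof
    fix x
    show "0 \<le> x \<bullet> ((Z - (1 / (Z $ k $ k)) *\<^sub>R outer z z) *v x)"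
    proof (cases "Z $ k $ k = 0")
      case True
      then show ?thesis using psd by (simp add: pos_semidef_def)
    next
      case False
      \<comment> \<open>Among the points \<open>x - q e_k\<close> the form of \<open>Z\<close> is
        smallest at this \<open>q\<close>, and its minimum is the form of the eliminated matrix at
        \<open>x\<close>.\<close>
      define q where "q = (z \<bullet> x) / Z $ k $ k"
      have "0 \<le> (x - q *\<^sub>R ?e) \<bullet> (Z *v (x - q *\<^sub>R ?e))"
        using psd by (simp add: pos_semidef_def)
      also have "\<dots> = x \<bullet> (Z *v x) - 2 * q * (z \<bullet> x) + q\<^sup>2 * Z $ k $ k"
        using symmetric_mat_inner[OF sym, of ?e x] kk
        by (simp add: matrix_vector_mult_diff_distrib matrix_vector_mult_scaleR inner_diff_left
            inner_diff_right power2_eq_square z_def inner_commute[of _ x] algebra_simps)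
      also have "\<dots> = x \<bullet> (Z *v x) - (z \<bullet> x)\<^sup>2 / Z $ k $ k"
        using False by (simp add: q_def divide_simps power2_eq_square)
      also have "\<dots> = x \<bullet> ((Z - (1 / (Z $ k $ k)) *\<^sub>R outer z z) *v x)"
        by (simp add: matrix_vector_mult_diff_rdistrib scaleR_matrix_vector_assoc[symmetric]
            outer_vector_mult inner_diff_right power2_eq_square inner_commute)
      finally show ?thesis .
    qed
  qed
qed

text \<open>Elimination writes \<open>Z\<close> as a sum of matrices \<open>outer z z\<close> with
  nonnegative weights, and each of them contributes a nonnegative multiple of
  \<open>z \<bullet> (B *v z)\<close>.\<close>

lemma trace_mult_psd_nonneg:
  fixes B Z :: "real^'n^'n"
  assumes "pos_semidef B" "symmetric_mat Z" "pos_semidef Z"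
  shows "0 \<le> trace (B ** Z)"
proof -
  \<comment> \<open>\<open>S\<close> contains all rows of \<open>Z\<close> that may be nonzero.
    Eliminating with pivot \<open>k\<close> clears row \<open>k\<close> and keeps zero rows zero, so
    induction applies to the remainder.\<close>
  have "0 \<le> trace (B ** Z)"
    if "finite S" "symmetric_mat Z" "pos_semidef Z" "\<And>i j. i \<notin> S \<Longrightarrow> Z $ i $ j = 0" for S Z
    using that
  proof (induction S arbitrary: Z rule: finite_induct)
    case empty
    then have "Z = 0" by (simp add: vec_eq_iff)
    then show ?case by (simp add: trace_def)
  next
    case (insert k S)
    define z where "z = Z *v axis k 1"
    define Z' where "Z' = Z - (1 / (Z $ k $ k)) *\<^sub>R outer z z"
    note elim = psd_eliminate[OF insert.prems(1,2), of k, folded z_def, folded Z'_def]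
    have "Z' $ i $ j = 0" if "i \<notin> S" for i j
    proof (cases "i = k")
      case True
      then show ?thesis
        using elim(4)[of i j] elim(5)[of j] symmetric_mat_nth[OF insert.prems(1), of j k]
        by (cases "Z $ k $ k = 0") auto
    next
      case False
      with that insert.prems(3) have "Z $ i $ j = 0" "Z $ i $ k = 0" by auto
      then show ?thesis using elim(4)[of i j] by simp
    qed
    then have "0 \<le> trace (B ** Z')"
      using insert.IH elim(1,2) by blast
    moreover have "trace (B ** Z) = trace (B ** Z') + (1 / Z $ k $ k) * (z \<bullet> (B *v z))"
    proof -
      have "B ** Z = B ** (Z' + (1 / Z $ k $ k) *\<^sub>R outer z z)" by (simp add: Z'_def)
      also have "\<dots> = B ** Z' + (1 / Z $ k $ k) *\<^sub>R (B ** outer z z)"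
        unfolding matrix_add_ldistrib by (simp only: matrix_scalar_ac scalar_matrix_assoc)
      finally show ?thesis
        by (simp add: trace_add trace_scaleR trace_mult_outer)
    qed
    \<comment> \<open>For a zero pivot the weight is \<open>1 / 0 = 0\<close>, so the bound covers
      that case too.\<close>
    moreover have "0 \<le> (1 / Z $ k $ k) * (z \<bullet> (B *v z))"
      using assms(1) elim(3) by (simp add: pos_semidef_def)
    ultimately show ?case by simp
  qed
  from this[of UNIV Z] assms show ?thesis by simp
qed

text \<open>The least eigenvalue is the minimum of the Rayleigh quotient, attained on the unit sphere.\<close>

lemma pos_semidef_sub_lambda_min:
  fixes A :: "real^'n^'n"
  assumes sym: "symmetric_mat A"
  shows "pos_semidef (A - lambda_min A *\<^sub>R mat 1)"
proof -
  let ?S = "sphere (0 :: real^'n) 1"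
  have "axis undefined 1 \<in> ?S" by (simp add: norm_axis_1)
  then have "?S \<noteq> {}" by blast
  moreover have "continuous_on ?S (\<lambda>x. x \<bullet> (A *v x))"
    by (intro continuous_intros matrix_vector_mult_linear_continuous_on)
  ultimately obtain v where v: "v \<in> ?S" and min: "\<And>x. x \<in> ?S \<Longrightarrow> v \<bullet> (A *v v) \<le> x \<bullet> (A *v x)"
    using continuous_attains_inf[of ?S "\<lambda>x. x \<bullet> (A *v x)"] by auto
  define l where "l = v \<bullet> (A *v v)"
  define B where "B = A - l *\<^sub>R mat 1"
  have form: "B *v x = A *v x - l *\<^sub>R x" for x
    by (simp add: B_def matrix_vector_mult_diff_rdistrib matrix_vector_mult_scaled_id)
  have psd: "pos_semidef B"
    unfolding pos_semidef_def
  proof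
    fix x
    show "0 \<le> x \<bullet> (B *v x)"
    proof (cases "x = 0")
      case False
      define u where "u = x /\<^sub>R norm x"
      have "l \<le> u \<bullet> (A *v u)" unfolding l_def using False by (intro min) (simp add: u_def)
      moreover have "x = norm x *\<^sub>R u" using False by (simp add: u_def)
      then have "x \<bullet> (A *v x) = (norm x)\<^sup>2 * (u \<bullet> (A *v u))"
        by (metis inner_scaleR_left inner_scaleR_right matrix_vector_mult_scaleR mult.assoc power2_eq_square)
      ultimately have "l * (norm x)\<^sup>2 \<le> x \<bullet> (A *v x)"
        by (simp add: mult.commute mult_right_mono)
      then show ?thesis by (simp add: form inner_diff_right power2_norm_eq_inner)
    qed simp
  qed
  have symB: "symmetric_mat B"
    unfolding B_def by (intro symmetric_mat_diff symmetric_mat_scaleR sym) (simp add: symmetric_mat_def)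
  have vv: "v \<bullet> v = 1" using v by (simp add: norm_eq_1)
  then have "v \<bullet> (B *v v) = 0" by (simp add: form inner_diff_right l_def)
  \<comment> \<open>The minimizer \<open>v\<close> is a zero of the nonnegative form of
    \<open>B\<close>, hence in its kernel.\<close>
  then have "A *v v = l *\<^sub>R v"
    using psd_quadratic_zero_imp_kernel[OF symB psd] form by fastforce
  then have "is_eigenvalue A l"
    using vv unfolding is_eigenvalue_def by (intro exI[of _ v]) auto
  \<comment> \<open>Testing the form of \<open>B\<close> on an eigenvector for \<open>k\<close>
    shows that \<open>l\<close> is the least eigenvalue, which evaluates the \<open>LEAST\<close> in
    \<open>lambda_min\<close>.\<close>
  moreover have "l \<le> k" if "is_eigenvalue A k" for k
  proof -
    obtain w where w: "w \<noteq> 0" "A *v w = k *\<^sub>R w" using \<open>is_eigenvalue A k\<close> is_eigenvalue_def by blast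
    have "0 \<le> w \<bullet> (B *v w)" using psd by (simp add: pos_semidef_def)
    then have "0 \<le> (k - l) * (w \<bullet> w)" by (simp add: form w algebra_simps)
    moreover have "w \<bullet> w > 0" using w(1) by simp
    ultimately show ?thesis by (simp add: zero_le_mult_iff)
  qed
  ultimately have "lambda_min A = l" unfolding lambda_min_def by (intro Least_equality)
  then show ?thesis using psd B_def by simp
qed

section \<open>Block matrices and the Schur complement\<close>

lemma sum_UNIV_option: "sum f (UNIV :: 'n::finite option set) = f None + (\<Sum>i\<in>UNIV. f (Some i))"
  by (simp add: UNIV_option_conv sum.reindex)

lemma bordered_nth [simp]:
  "bordered B v c $ Some i $ Some j = B $ i $ j"
  "bordered B v c $ Some i $ None = v $ i"
  "bordered B v c $ None $ Some j = v $ j"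
  "bordered B v c $ None $ None = c"
  by (simp_all add: bordered_def)

lemma symmetric_mat_bordered_eq:
  assumes "symmetric_mat X"
  shows "X = bordered (\<chi> i j. X $ Some i $ Some j) (\<chi> i. X $ Some i $ None) (X $ None $ None)"
  unfolding vec_eq_iff
proof (intro allI)
  fix i j
  show "X $ i $ j = bordered (\<chi> i j. X $ Some i $ Some j) (\<chi> i. X $ Some i $ None) (X $ None $ None) $ i $ j"
    using symmetric_mat_nth[OF assms] by (cases i; cases j) auto
qed

lemma symmetric_mat_borderedD: "symmetric_mat (bordered Y x c) \<Longrightarrow> symmetric_mat Y"
  using symmetric_mat_nth[of "bordered Y x c" "Some _" "Some _"]
  by (simp add: symmetric_mat_def[of Y] transpose_def vec_eq_iff)

text \<open>The factor 2 comes from the two off-diagonal blocks; it cancels the halves in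
  \<open>matM\<close> and \<open>matH\<close>.\<close>

lemma trace_bordered_mult:
  "trace (bordered B v c ** bordered C w e) = trace (B ** C) + 2 * (v \<bullet> w) + c * e"
  by (simp add: trace_def matrix_matrix_mult_def sum_UNIV_option inner_vec_def sum.distrib)

text \<open>Makes the lift of a point \<open>x\<close> visibly positive semidefinite: it is the
  rank-one matrix of the vector \<open>(x, 1)\<close>.\<close>

lemma bordered_outer: "bordered (outer x x) x 1 = outer (\<chi> i. case i of None \<Rightarrow> 1 | Some k \<Rightarrow> x $ k)
    (\<chi> i. case i of None \<Rightarrow> 1 | Some k \<Rightarrow> x $ k)"
  by (simp add: vec_eq_iff bordered_def outer_def split: option.split)

lemma psd_outer: "outer x x \<in> psd_cone"
  by (simp add: psd_cone_def symmetric_mat_outer pos_semidef_def outer_vector_mult inner_commute)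

text \<open>At \<open>(w, c)\<close> the bordered form is \<open>w^T Y w + 2 c x^T w + c^2\<close>.
  The choice \<open>c = - (x \<bullet> w)\<close> minimizes it and leaves the form of the Schur
  complement at \<open>w\<close>.\<close>

lemma schur_complement_psd:
  fixes Y :: "real^'n^'n"
  assumes psd: "pos_semidef (bordered Y x 1)"
  shows "pos_semidef (Y - outer x x)"
  unfolding pos_semidef_def
proof
  fix w :: "real^'n"
  define u where "u = (\<chi> i. case i of None \<Rightarrow> - (x \<bullet> w) | Some k \<Rightarrow> w $ k)"
  have "0 \<le> u \<bullet> (bordered Y x 1 *v u)"
    using psd by (simp add: pos_semidef_def)
  also have "\<dots> = w \<bullet> (Y *v w) - (x \<bullet> w)\<^sup>2"
  proof -
    have top: "(bordered Y x 1 *v u) $ None = 0"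
      by (simp add: matrix_vector_mult_def sum_UNIV_option u_def inner_vec_def)
    have "(bordered Y x 1 *v u) $ Some i = (Y *v w) $ i - (x \<bullet> w) * x $ i" for i
      by (simp add: matrix_vector_mult_def sum_UNIV_option u_def)
    with top have "u \<bullet> (bordered Y x 1 *v u) = (\<Sum>i\<in>UNIV. w $ i * ((Y *v w) $ i - (x \<bullet> w) * x $ i))"
      by (simp add: inner_vec_def[of u] sum_UNIV_option) (simp add: u_def)
    also have "\<dots> = w \<bullet> (Y *v w - (x \<bullet> w) *\<^sub>R x)"
      by (simp add: inner_vec_def)
    finally show ?thesis
      by (simp add: inner_diff_right power2_eq_square inner_commute)
  qed
  also have "\<dots> = w \<bullet> ((Y - outer x x) *v w)"
    by (simp add: matrix_vector_mult_diff_rdistrib outer_vector_mult inner_diff_right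
        power2_eq_square inner_commute)
  finally show "0 \<le> w \<bullet> ((Y - outer x x) *v w)" .
qed

section \<open>The relaxation in block form\<close>

text \<open>The linear constraints see only the border \<open>x\<close>, and the ball constraint
  sees \<open>Y\<close> only through its trace. This is what lets the excess of \<open>Y\<close>
  over \<open>outer x x\<close> be traded for a displacement of \<open>x\<close>.\<close>

lemma SDRP_feasible_bordered_iff:
  "bordered Y x 1 \<in> SDRP_feasible x0 \<alpha> m b \<beta> \<longleftrightarrow>
    bordered Y x 1 \<in> psd_cone \<and> trace Y - 2 * (x0 \<bullet> x) + (norm x0)\<^sup>2 \<le> \<alpha> \<and>
    (\<forall>i\<in>{1..m}. b i \<bullet> x \<le> \<beta> i)"
  by (auto simp: SDRP_feasible_def matH0_def matH_def trace_bordered_mult trace_def[of 0])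

lemma trace_matM_bordered: "trace (matM A a ** bordered Y x 1) = trace (A ** Y) + a \<bullet> x"
  by (simp add: matM_def trace_bordered_mult)

text \<open>For \<open>Y = outer x x\<close> the relaxed ball expression is exactly the squared
  distance from \<open>x\<close> to \<open>x0\<close>.\<close>

lemma SDRP_feasible_lift:
  assumes "x \<in> P_feasible x0 \<alpha> m b \<beta>"
  shows "bordered (outer x x) x 1 \<in> SDRP_feasible x0 \<alpha> m b \<beta>"
proof -
  have "bordered (outer x x) x 1 \<in> psd_cone"
    unfolding bordered_outer by (rule psd_outer)
  moreover have "(norm (x - x0))\<^sup>2 = x \<bullet> x - 2 * (x0 \<bullet> x) + (norm x0)\<^sup>2"
    by (simp add: power2_norm_eq_inner inner_diff_left inner_diff_right inner_commute)
  ultimately show ?thesis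
    using assms by (simp add: SDRP_feasible_bordered_iff P_feasible_def trace_outer)
qed

section \<open>A unit eigenvector orthogonal to the constraint normals\<close>

text \<open>The orthogonal complement of \<open>T\<close> has codimension \<open>dim T\<close>, so
  it meets \<open>S\<close> in dimension at least \<open>dim S - dim T\<close>, which is positive; a
  nonzero vector there is normalized.\<close>

lemma exists_unit_orthogonal_in_subspace:
  fixes S T :: "'a::euclidean_space set"
  assumes "subspace S" "dim T < dim S"
  obtains d where "d \<in> S" "norm d = 1" "\<And>y. y \<in> T \<Longrightarrow> d \<bullet> y = 0"
proof -
  let ?U = "{y. \<forall>x\<in>T. orthogonal x y}"
  have "subspace ?U" by (simp add: subspace_orthogonal_to_vectors)
  have "dim {y \<in> UNIV. \<forall>x\<in>span T. orthogonal x y} + dim (span T) = DIM('a)"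
    using dim_subspace_orthogonal_to_vectors[of "span T" UNIV] by simp
  moreover have "{y \<in> UNIV. \<forall>x\<in>span T. orthogonal x y} = ?U"
    by (auto intro: span_base simp: orthogonal_commute orthogonal_to_span)
  ultimately have "dim ?U + dim T = DIM('a)" by simp
  moreover have "dim {x + y |x y. x \<in> S \<and> y \<in> ?U} + dim (S \<inter> ?U) = dim S + dim ?U"
    by (rule dim_sums_Int) fact+
  moreover have "dim {x + y |x y. x \<in> S \<and> y \<in> ?U} \<le> DIM('a)"
    by (rule dim_subset_UNIV)
  ultimately have "dim (S \<inter> ?U) > 0" using assms(2) by linarith
  then have "\<not> S \<inter> ?U \<subseteq> {0}" using dim_eq_0[of "S \<inter> ?U"] by linarith
  then obtain e where e: "e \<in> S \<inter> ?U" "e \<noteq> 0" by blast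
  show ?thesis
  proof
    show "e /\<^sub>R norm e \<in> S" using e assms(1) by (simp add: subspace_scale)
    show "norm (e /\<^sub>R norm e) = 1" using e by simp
    show "(e /\<^sub>R norm e) \<bullet> y = 0" if "y \<in> T" for y
      using e that by (simp add: orthogonal_def inner_commute[of e])
  qed
qed

lemma subspace_Ker: "subspace (Ker M)"
  by (simp add: Ker_def subspace_def matrix_vector_right_distrib matrix_vector_mult_scaleR)

section \<open>From relaxed solutions to feasible points\<close>

text \<open>Treating each relaxed matrix separately yields the nontrivial inequality of optimal
  values and also covers infeasibility: a feasible \<open>X\<close> forces (P) to be
  feasible.\<close>

lemma feasible_point_below_relaxed_value:
  fixes A :: "real^'n^'n"
  assumes sym: "symmetric_mat A"
    and X: "X \<in> SDRP_feasible x0 \<alpha> m b \<beta>"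
    and d: "norm d = 1" "A *v d = lambda_min A *\<^sub>R d" "\<And>i. i \<in> {1..m} \<Longrightarrow> d \<bullet> b i = 0"
    and sign: "2 * lambda_min A * (d \<bullet> x0) + a \<bullet> d \<le> 0"
  shows "\<exists>y \<in> P_feasible x0 \<alpha> m b \<beta>. y \<bullet> (A *v y) + a \<bullet> y \<le> trace (matM A a ** X)"
proof -
  define l where "l = lambda_min A"
  define Y where "Y = (\<chi> i j. X $ Some i $ Some j)"
  define x where "x = (\<chi> i. X $ Some i $ None)"
  have psdX: "symmetric_mat X" "pos_semidef X" "X $ None $ None = 1"
    using X by (auto simp: SDRP_feasible_def psd_cone_def)
  have eq: "X = bordered Y x 1"
    using symmetric_mat_bordered_eq[OF psdX(1)] psdX(3) by (simp add: Y_def x_def)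
  have feas: "trace Y - 2 * (x0 \<bullet> x) + (norm x0)\<^sup>2 \<le> \<alpha>" "\<And>i. i \<in> {1..m} \<Longrightarrow> b i \<bullet> x \<le> \<beta> i"
    using X by (auto simp: eq SDRP_feasible_bordered_iff)
  define Z where "Z = Y - outer x x"
  have psdZ: "pos_semidef Z"
    unfolding Z_def using psdX(2) eq by (simp add: schur_complement_psd)
  have symZ: "symmetric_mat Z"
    unfolding Z_def using psdX(1) eq
    by (metis symmetric_mat_borderedD symmetric_mat_diff symmetric_mat_outer)
  define t where "t = trace Z"
  have t: "t \<ge> 0"
    using trace_mult_psd_nonneg[of "mat 1" Z] psdZ symZ by (simp add: t_def pos_semidef_def)
  have trY: "trace Y = x \<bullet> x + t"
    by (simp add: t_def Z_def trace_sub trace_outer)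
  \<comment> \<open>Both factors are positive semidefinite; expanding the product bounds
    \<open>trace (A ** Z)\<close> below by \<open>l * t\<close>.\<close>
  have "0 \<le> trace ((A - l *\<^sub>R mat 1) ** Z)"
    using trace_mult_psd_nonneg pos_semidef_sub_lambda_min[OF sym] psdZ symZ by (simp add: l_def)
  also have "(A - l *\<^sub>R mat 1) ** Z = A ** Z - l *\<^sub>R Z"
    by (simp add: matrix_eq matrix_vector_mul_assoc[symmetric] matrix_vector_mult_diff_rdistrib
        matrix_vector_mult_scaled_id scaleR_matrix_vector_assoc[symmetric])
  finally have "l * t \<le> trace (A ** Z)" by (simp add: trace_sub trace_scaleR t_def)
  moreover have "A ** Y = A ** Z + A ** outer x x"
    unfolding Z_def by (metis diff_add_cancel matrix_add_ldistrib)
  ultimately have trAY: "x \<bullet> (A *v x) + l * t \<le> trace (A ** Y)"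
    by (simp add: trace_add trace_mult_outer)
  define p where "p = d \<bullet> (x - x0)"
  \<comment> \<open>The larger root of \<open>r^2 + 2 p r = t\<close>. It is nonnegative because
    \<open>t \<ge> 0\<close>, so multiplying the inequality \<open>sign\<close> by \<open>r\<close>
    preserves its direction.\<close>
  define r where "r = sqrt (p\<^sup>2 + t) - p"
  have "\<bar>p\<bar> \<le> sqrt (p\<^sup>2 + t)" using t by (intro real_le_rsqrt) auto
  then have r: "r \<ge> 0" by (simp add: r_def)
  have "(r + p)\<^sup>2 = p\<^sup>2 + t" using t by (simp add: r_def)
  then have root: "r\<^sup>2 + 2 * r * p = t" by (simp add: power2_eq_square algebra_simps)
  have dd: "d \<bullet> d = 1" using d(1) by (simp add: norm_eq_1)
  define y where "y = x + r *\<^sub>R d"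
  have "(norm (y - x0))\<^sup>2 = (norm (x - x0))\<^sup>2 + (r\<^sup>2 + 2 * r * p)"
    using dd unfolding power2_norm_eq_inner
    by (simp add: y_def p_def inner_simps inner_commute power2_eq_square algebra_simps)
  \<comment> \<open>The added \<open>t\<close> turns \<open>x \<bullet> x\<close> into
    \<open>trace Y\<close>, so \<open>y\<close> inherits the ball constraint from
    \<open>X\<close>.\<close>
  also have "\<dots> = trace Y - 2 * (x0 \<bullet> x) + (norm x0)\<^sup>2"
    unfolding root trY
    by (simp add: power2_norm_eq_inner inner_diff_left inner_diff_right inner_commute)
  finally have "(norm (y - x0))\<^sup>2 \<le> \<alpha>" using feas(1) by simp
  moreover have "b i \<bullet> y \<le> \<beta> i" if "i \<in> {1..m}" for i
    using feas(2)[OF that] d(3)[OF that] by (simp add: y_def inner_add_right inner_commute)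
  ultimately have "y \<in> P_feasible x0 \<alpha> m b \<beta>" by (simp add: P_feasible_def)
  moreover have "y \<bullet> (A *v y) + a \<bullet> y \<le> trace (matM A a ** X)"
  proof -
    have "d \<bullet> (A *v x) = l * (d \<bullet> x)"
      using symmetric_mat_inner[OF sym, of d x] d(2) by (simp add: l_def inner_commute)
    then have "y \<bullet> (A *v y) = x \<bullet> (A *v x) + l * (r\<^sup>2 + 2 * r * (d \<bullet> x))"
      using d(2) dd
      by (simp add: y_def l_def matrix_vector_right_distrib matrix_vector_mult_scaleR inner_add_left
          inner_add_right inner_commute power2_eq_square algebra_simps)
    \<comment> \<open>The equation for \<open>r\<close> involves \<open>x - x0\<close> and the
      objective involves \<open>x\<close>; the mismatch is the \<open>x0\<close> term controlled by
      \<open>sign\<close>.\<close>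
    also have "r\<^sup>2 + 2 * r * (d \<bullet> x) = t + 2 * r * (d \<bullet> x0)"
      unfolding root[symmetric] p_def by (simp add: inner_diff_right algebra_simps)
    finally have "y \<bullet> (A *v y) + a \<bullet> y
        = x \<bullet> (A *v x) + l * t + a \<bullet> x + r * (2 * l * (d \<bullet> x0) + a \<bullet> d)"
      by (simp add: y_def inner_add_right algebra_simps)
    also have "\<dots> \<le> x \<bullet> (A *v x) + l * t + a \<bullet> x"
      using r sign by (simp add: l_def mult_nonneg_nonpos)
    also have "\<dots> \<le> trace (matM A a ** X)"
      using trAY by (simp add: eq trace_matM_bordered)
    finally show ?thesis .
  qed
  ultimately show ?thesis by blast
qed

theorem theorem3p1:
  fixes A :: "real^'n^'n"
    and a x0 :: "real^'n"
    and b :: "nat \<Rightarrow> real^'n"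
    and \<beta> :: "nat \<Rightarrow> real"
    and \<alpha> :: real
    and m s :: nat
  assumes "symmetric_mat A"
    and "\<not> pos_semidef A"
    and "\<alpha> > 0"
    and "s = dim (span (b ` {1..m}))"
    and "dim (Ker (A - lambda_min A *\<^sub>R mat 1)) \<ge> s + 1"
  shows "min_P A a x0 \<alpha> m b \<beta> = min_SDRP A a x0 \<alpha> m b \<beta>"
proof (rule antisym)
  obtain d where d: "d \<in> Ker (A - lambda_min A *\<^sub>R mat 1)" "norm d = 1"
    "\<And>y. y \<in> b ` {1..m} \<Longrightarrow> d \<bullet> y = 0"
    using exists_unit_orthogonal_in_subspace[OF subspace_Ker, of "b ` {1..m}"] assms(4,5)
    by (metis Suc_eq_plus1 Suc_le_eq dim_span)
  have eig: "A *v d = lambda_min A *\<^sub>R d"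
    using d(1) by (simp add: Ker_def matrix_vector_mult_diff_rdistrib matrix_vector_mult_scaled_id)
  \<comment> \<open>The expression is odd in \<open>d\<close>, while the other properties of
    \<open>d\<close> survive negation, so one of the two signs fits.\<close>
  define e where "e = (if 2 * lambda_min A * (d \<bullet> x0) + a \<bullet> d \<le> 0 then d else - d)"
  have e: "norm e = 1" "A *v e = lambda_min A *\<^sub>R e" "\<And>i. i \<in> {1..m} \<Longrightarrow> e \<bullet> b i = 0"
    "2 * lambda_min A * (e \<bullet> x0) + a \<bullet> e \<le> 0"
    using d(2,3) eig matrix_vector_mult_scaleR[of A "-1" d] by (auto simp: e_def)
  show "min_P A a x0 \<alpha> m b \<beta> \<le> min_SDRP A a x0 \<alpha> m b \<beta>"
    unfolding min_P_def min_SDRP_def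
  proof (rule INF_mono)
    fix X assume "X \<in> SDRP_feasible x0 \<alpha> m b \<beta>"
    from feasible_point_below_relaxed_value[OF assms(1) this e]
    show "\<exists>x\<in>P_feasible x0 \<alpha> m b \<beta>. ereal (x \<bullet> (A *v x) + a \<bullet> x) \<le> ereal (trace (matM A a ** X))"
      by simp
  qed
  show "min_SDRP A a x0 \<alpha> m b \<beta> \<le> min_P A a x0 \<alpha> m b \<beta>"
    unfolding min_P_def min_SDRP_def
  proof (rule INF_mono)
    fix x assume "x \<in> P_feasible x0 \<alpha> m b \<beta>"
    \<comment> \<open>The lift of \<open>x\<close> has the same objective value as
      \<open>x\<close>.\<close>
    then show "\<exists>X\<in>SDRP_feasible x0 \<alpha> m b \<beta>. ereal (trace (matM A a ** X)) \<le> ereal (x \<bullet> (A *v x) + a \<bullet> x)"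
      by (intro bexI[OF _ SDRP_feasible_lift]) (simp_all add: trace_matM_bordered trace_mult_outer)
  qed
qed

end
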